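(* Let $n,r$ be positive integers with $n\ge r$, and let $k_1,\dots,k_r$ be integers. Then $${n \brace k_1,k_2,\cdots,k_r} =\sum_{l=r}^n \sum_{m=r}^l (-1)^{l-m} {n \brace l}{l \brace m}{m \brack k_1,k_2,\cdots,k_r},$$ where ${n \brace k_1,\cdots,k_r}$ is the multi-Stirling number of the second kind, ${n \brace l}$ and ${l \brace m}$ are ordinary Stirling numbers of the second kind, and ${m \brack k_1,\cdots,k_r}$ is the unsigned multi-Stirling number of the first kind.
   Context: For integers $k_1,\dots,k_r$ the multiple logarithm of index $(k_1,\dots,k_r)$ is the power series $$\mathrm{Li}_{k_1,k_2,\cdots,k_r}(t)=\sum_{0<m_1<m_2<\cdots<m_r}\frac{t^{m_r}}{m_1^{k_1}m_2^{k_2}\cdots m_r^{k_r}},$$ the sum being over integers $m_1,\dots,m_r$. The multi-Stirling numbers of the second kind ${n \brace k_1,k_2,\cdots,k_r}$ are defined by the generating function (as a power series in $t$) $$\mathrm{Li}_{k_1,k_2,\cdots,k_r}(1-e^{1-e^t})=\sum_{n=r}^\infty {n \brace k_1,k_2,\cdots,k_r}\frac{t^n}{n!}.$$ The unsigned multi-Stirling numbers of the first kind ${n \brack k_1,k_2,\cdots,k_r}$ are defined by $$\mathrm{Li}_{k_1,k_2,\cdots,k_r}(t)=\sum_{n=r}^\infty{n \brack k_1,k_2,\cdots,k_r}\frac{t^n}{n!}.$$ The Stirling numbers of the second kind ${n \brace k}$ are given by $\frac{1}{k!}(e^t-1)^k=\sum_{n=k}^\infty {n \brace k}\frac{t^n}{n!}$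 for $k\ge 0$. *)

theory Defs
  imports
    "HOL-Computational_Algebra.Formal_Power_Series"
    "HOL-Combinatorics.Stirling"
begin

text \<open>
  An index \<open>(k\<^sub>1, \<dots>, k\<^sub>r)\<close> is a list of integers, and \<open>r\<close> is its length. All power series
  are formal, with coefficients in an arbitrary field of characteristic \<open>0\<close>.

  Prefixing \<open>0\<close> to \<open>ms\<close> makes strict sortedness express \<open>0 < m\<^sub>1 < \<dots> < m\<^sub>r\<close>, and makes the
  last entry equal to \<open>m\<^sub>r\<close> (and equal to \<open>0\<close> if \<open>r = 0\<close>).
\<close>

definition log_indices :: "nat \<Rightarrow> nat \<Rightarrow> nat list set" where
  "log_indices r N = {ms. length ms = r \<and> sorted_wrt (<) (0 # ms) \<and> last (0 # ms) = N}"

definition multi_log :: "int list \<Rightarrow> 'a::field_char_0 fps" where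
  "multi_log ks = Abs_fps (\<lambda>N. \<Sum>ms\<in>log_indices (length ks) N.
     1 / (\<Prod>i<length ks. of_nat (ms ! i) powi (ks ! i)))"

definition multi_stirling1 :: "nat \<Rightarrow> int list \<Rightarrow> 'a::field_char_0" where
  "multi_stirling1 n ks = fact n * fps_nth (multi_log ks) n"

text \<open>
  Both compositions below are of the admissible kind: \<open>1 - e\<^sup>t\<close> and \<open>1 - exp (1 - e\<^sup>t)\<close>
  have constant term \<open>0\<close>.
\<close>

definition multi_stirling2 :: "nat \<Rightarrow> int list \<Rightarrow> 'a::field_char_0" where
  "multi_stirling2 n ks =
     fact n * fps_nth (fps_compose (multi_log ks)
                         (1 - fps_compose (fps_exp 1) (1 - fps_exp 1))) n"

text \<open>
  The sums defining the coefficients of the multiple logarithm are finite, so that they are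
  not set to \<open>0\<close> by convention.
\<close>

lemma sorted_wrt_less_le_last:
  fixes xs :: "nat list"
  assumes "sorted_wrt (<) xs" "x \<in> set xs"
  shows "x \<le> last xs"
proof -
  obtain i where i: "i < length xs" "x = xs ! i"
    using assms(2) by (metis in_set_conv_nth)
  have "xs ! i \<le> xs ! (length xs - 1)"
    using i sorted_wrt_nth_less[OF assms(1), of i "length xs - 1"]
    by (cases "i = length xs - 1") (simp_all add: less_imp_le)
  moreover have "xs \<noteq> []" using i by auto
  ultimately show ?thesis using i by (simp add: last_conv_nth)
qed

lemma finite_log_indices: "finite (log_indices r N)"
proof (rule finite_subset)
  show "log_indices r N \<subseteq> {ms. set ms \<subseteq> {..N} \<and> length ms = r}"
    using sorted_wrt_less_le_last unfolding log_indices_def by fastforce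
  show "finite {ms. set ms \<subseteq> {..N} \<and> length ms = r}"
    by (rule finite_lists_length_eq) simp
qed

text \<open>The generating functions have no terms of degree less than \<open>r\<close>.\<close>

lemma log_indices_empty:
  assumes "N < r"
  shows "log_indices r N = {}"
proof (rule ccontr)
  assume "log_indices r N \<noteq> {}"
  then obtain ms where ms: "length ms = r" "sorted_wrt (<) (0 # ms)" "last (0 # ms) = N"
    unfolding log_indices_def by blast
  have "set (0 # ms) \<subseteq> {..N}"
    using sorted_wrt_less_le_last[OF ms(2)] ms(3) by auto
  then have "card (set (0 # ms)) \<le> card {..N}" by (intro card_mono) auto
  moreover have "distinct (0 # ms)"
    using ms(2) strict_sorted_iff by blast
  ultimately show False using ms(1) assms by (simp add: distinct_card)
qed

lemma multi_log_nth_eq_0: "n < length ks \<Longrightarrow> fps_nth (multi_log ks) n = 0"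
  by (simp add: multi_log_def log_indices_empty)

lemma multi_stirling1_gf:
  "multi_log ks = Abs_fps (\<lambda>n. if length ks \<le> n then multi_stirling1 n ks / fact n else 0)"
  by (rule fps_ext) (simp add: multi_stirling1_def multi_log_nth_eq_0)

lemma multi_stirling2_gf:
  "fps_compose (multi_log ks) (1 - fps_compose (fps_exp 1) (1 - fps_exp 1)) =
     Abs_fps (\<lambda>n. if length ks \<le> n then multi_stirling2 n ks / fact n else 0)"
  by (rule fps_ext)
     (auto simp: multi_stirling2_def fps_compose_nth multi_log_nth_eq_0 intro!: sum.neutral)

text \<open>
  The library's \<^const>\<open>Stirling\<close> is defined by its recurrence; it has the expected
  exponential generating function.
\<close>

lemma Stirling_gf:
  "fps_const (1 / fact k) * (fps_exp 1 - 1) ^ k =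
     (Abs_fps (\<lambda>n. of_nat (Stirling n k) / fact n) :: 'a::field_char_0 fps)"
proof -
  define F :: "nat \<Rightarrow> 'a fps" where "F k = fps_const (1 / fact k) * (fps_exp 1 - 1) ^ k" for k
  have deriv: "fps_deriv (F (Suc k)) = F k + of_nat (Suc k) * F (Suc k)" for k
  proof -
    have c: "fps_const (1 / fact (Suc k)) * of_nat (Suc k) = fps_const (1 / fact k :: 'a)"
      by (simp add: fps_of_nat [symmetric] field_simps del: of_nat_Suc)
    have p: "fps_deriv ((fps_exp 1 - 1 :: 'a fps) ^ Suc k) =
        of_nat (Suc k) * ((fps_exp 1 - 1) ^ k * fps_exp 1)"
      by (subst fps_deriv_power') (simp add: mult_ac del: of_nat_Suc)
    have "fps_deriv (F (Suc k)) =
        (fps_const (1 / fact (Suc k)) * of_nat (Suc k)) * ((fps_exp 1 - 1) ^ k * fps_exp 1)"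
      by (simp only: F_def fps_deriv_mult fps_deriv_const p) (simp add: mult.assoc)
    also have "\<dots> = fps_const (1 / fact k) * (fps_exp 1 - 1) ^ k
        + (fps_const (1 / fact (Suc k)) * of_nat (Suc k)) * (fps_exp 1 - 1) ^ Suc k"
      unfolding c by (simp add: algebra_simps)
    finally show ?thesis by (simp add: F_def algebra_simps del: of_nat_Suc fact_Suc)
  qed
  have "fps_nth (F k) n = of_nat (Stirling n k) / fact n" for n k
  proof (induction n arbitrary: k)
    case 0
    then show ?case by (cases k) (simp_all add: F_def)
  next
    case (Suc n)
    show ?case
    proof (cases k)
      case 0
      then show ?thesis by (simp add: F_def)
    next
      case (Suc j)
      have "of_nat (Suc n) * fps_nth (F (Suc j)) (Suc n) = fps_nth (fps_deriv (F (Suc j))) n"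
        by simp
      also have "\<dots> = fps_nth (F j) n + of_nat (Suc j) * fps_nth (F (Suc j)) n"
        unfolding deriv by (simp add: fps_of_nat [symmetric] del: of_nat_Suc)
      also have "\<dots> = of_nat (Stirling (Suc n) (Suc j)) / fact n"
        by (simp add: Suc.IH field_simps)
      finally show ?thesis using Suc by (simp add: field_simps del: of_nat_Suc)
    qed
  qed
  then show ?thesis by (intro fps_ext) (simp add: F_def)
qed

end

theory Submission imports Defs begin

text \<open>
  Composing an exponential generating function with \<open>e\<^sup>t - 1\<close> multiplies the sequence of its
  coefficients by the matrix of Stirling numbers of the second kind
  (\<open>fact_mult_nth_compose_exp_minus_1\<close>). Conjugating this with \<open>t \<mapsto> - t\<close> shows that composing
  with \<open>1 - e\<^sup>-\<^sup>t\<close> multiplies it by the same matrix with alternating signs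
  (\<open>fact_mult_nth_compose_1_minus_exp\<close>). The inner series \<open>1 - e\<^bsup>1 - e\<^sup>t\<^esup>\<close> of the multi-Stirling
  numbers of the second kind is \<open>1 - e\<^sup>-\<^sup>u\<close> at \<open>u = e\<^sup>t - 1\<close>, so it applies the signed
  matrix and then the unsigned one to the multi-Stirling numbers of the first kind. Since the
  latter vanish below \<open>r\<close> and \<open>Stirling\<close> is triangular, both sums may start at \<open>r\<close>.
\<close>

lemma fact_mult_nth_compose_exp_minus_1:
  fixes A :: "'a::field_char_0 fps"
  shows "fact n * fps_nth (fps_compose A (fps_exp 1 - 1)) n =
    (\<Sum>l\<le>n. of_nat (Stirling n l) * (fact l * fps_nth A l))"
proof -
  have power_nth: "fps_nth ((fps_exp 1 - 1 :: 'a fps) ^ l) n = fact l * of_nat (Stirling n l) / fact n"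
    for l
    using arg_cong[OF Stirling_gf[where 'a = 'a, of l], of "\<lambda>f. fps_nth f n"]
    by (simp add: field_simps)
  show ?thesis
    by (simp add: fps_compose_nth power_nth sum_distrib_left atLeast0AtMost mult_ac)
qed

lemma nth_compose_uminus_X: "fps_nth (fps_compose A (- fps_X)) n = (-1) ^ n * fps_nth (A :: 'a::comm_ring_1 fps) n"
  by (simp add: fps_compose_uminus')

text \<open>
  As \<open>1 - e\<^sup>-\<^sup>t\<close> is the conjugate of \<open>e\<^sup>t - 1\<close> by \<open>t \<mapsto> - t\<close>, and this substitution multiplies
  the coefficient of index \<open>j\<close> by \<open>(-1)\<^sup>j\<close>, the two substitutions together give the sign
  \<open>(-1)\<^bsup>l + m\<^esup> = (-1)\<^bsup>l - m\<^esup>\<close>.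
\<close>
lemma fact_mult_nth_compose_1_minus_exp:
  fixes A :: "'a::field_char_0 fps"
  shows "fact l * fps_nth (fps_compose A (1 - fps_exp (-1))) l =
    (\<Sum>m\<le>l. (-1) ^ (l - m) * of_nat (Stirling l m) * (fact m * fps_nth A m))"
proof -
  let ?u = "fps_exp 1 - 1 :: 'a fps"
  have "1 - fps_exp (-1) = fps_compose (- fps_X) (fps_compose ?u (- fps_X))"
    by (simp add: fps_compose_sub_distrib fps_compose_uminus)
  then have "fps_compose A (1 - fps_exp (-1)) =
      fps_compose (fps_compose (fps_compose A (- fps_X)) ?u) (- fps_X)"
    by (simp add: fps_compose_assoc)
  then have "fact l * fps_nth (fps_compose A (1 - fps_exp (-1))) l =
      (-1) ^ l * (fact l * fps_nth (fps_compose (fps_compose A (- fps_X)) ?u) l)"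
    by (simp add: nth_compose_uminus_X)
  also have "\<dots> = (\<Sum>m\<le>l. ((-1) ^ l * (-1) ^ m) * of_nat (Stirling l m) * (fact m * fps_nth A m))"
    by (simp only: fact_mult_nth_compose_exp_minus_1 nth_compose_uminus_X sum_distrib_left mult_ac)
  also have "\<dots> = (\<Sum>m\<le>l. (-1) ^ (l - m) * of_nat (Stirling l m) * (fact m * fps_nth A m))"
    by (intro sum.cong refl) (simp flip: power_add add: minus_one_power_iff)
  finally show ?thesis .
qed

lemma multi_stirling2_inner_series:
  "1 - fps_compose (fps_exp 1) (1 - fps_exp 1) =
    fps_compose (1 - fps_exp (-1)) (fps_exp 1 - 1 :: 'a::field_char_0 fps)"
proof -
  let ?u = "fps_exp 1 - 1 :: 'a fps"
  have "1 - fps_exp 1 = fps_compose (- fps_X) ?u"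
    by (simp add: fps_compose_uminus)
  then have "fps_compose (fps_exp 1) (1 - fps_exp 1) =
      fps_compose (fps_compose (fps_exp 1) (- fps_X)) ?u"
    by (simp add: fps_compose_assoc)
  then show ?thesis
    by (simp add: fps_compose_sub_distrib)
qed

theorem theorem4:
  fixes n r :: nat and ks :: "int list"
  assumes "1 \<le> r" and "r \<le> n" and "length ks = r"
  shows "(multi_stirling2 n ks :: 'a::field_char_0) =
    (\<Sum>l = r..n. \<Sum>m = r..l.
       (-1) ^ (l - m) * of_nat (Stirling n l) * of_nat (Stirling l m) * multi_stirling1 m ks)"
proof -
  let ?L = "multi_log ks :: 'a fps"
  define c :: "nat \<Rightarrow> nat \<Rightarrow> 'a" where
    "c l m = (-1) ^ (l - m) * of_nat (Stirling n l) * of_nat (Stirling l m) * multi_stirling1 m ks"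
    for l m
  have c_0: "c l m = 0" if "m < r" for l m
    using that assms(3) by (simp add: c_def multi_stirling1_def multi_log_nth_eq_0)
  have "multi_stirling2 n ks =
      fact n * fps_nth (fps_compose (fps_compose ?L (1 - fps_exp (-1))) (fps_exp 1 - 1)) n"
    unfolding multi_stirling2_def multi_stirling2_inner_series by (simp add: fps_compose_assoc)
  also have "\<dots> = (\<Sum>l\<le>n. \<Sum>m\<le>l. c l m)"
    by (simp add: fact_mult_nth_compose_exp_minus_1 fact_mult_nth_compose_1_minus_exp
        c_def multi_stirling1_def sum_distrib_left mult_ac)
  also have "\<dots> = (\<Sum>l\<le>n. \<Sum>m = r..l. c l m)"
    by (intro sum.cong sum.mono_neutral_right refl) (auto intro: c_0)
  also have "\<dots> = (\<Sum>l = r..n. \<Sum>m = r..l. c l m)"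
    by (intro sum.mono_neutral_right) auto
  finally show ?thesis
    by (simp add: c_def)
qed

end
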